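(* Let $n\ge1$ and let $T\subseteq\mathbb Z_{\ge1}$. Let $\mathcal F_n^+:=\bigl\{\sum_{e\mid n}b_e\ell_n^{(e)}:b_e\ge0\bigr\}$. The following are equivalent: (i) $f_n^T\in\mathcal F_n^+$; (ii) $T\cap\mathcal D(n)$ is empty or equals $\mathcal D(r)$ for some $r\mid n$; (iii) $f_n^T=0$ or $f_n^T=\ell_n^{(r)}$ for some $r\mid n$.
   Context: $\mathcal D(m)$ is the set of positive divisors of $m$. For $r\in\mathbb Z$, $\ell_n^{(r)}$ is the Frobenius characteristic of $\operatorname{Ind}_{C_n}^{S_n}V_r$, where $C_n=\langle(1\,2\cdots n)\rangle$ and $V_r$ is the one-dimensional complex $C_n$-module on which $(1\,2\cdots n)$ acts by $\exp(2\pi i r/n)$. The functions $\ell_n^{(e)}$, $e\mid n$, form a basis of the span of $\{p_d^{\,n/d}:d\mid n\}$, where $p_d$ is the power-sum symmetric function; the coefficients $b_e$ in $\mathcal F_n^+$ are real numbers. With $\mu$ the Möbius function, $$\psi^T(d):=\sum_{e\mid d,\, e\in T}e\,\mu(d/e),\qquad f_n^T:=\frac1n\sum_{d\mid n}\psi^T(d)\,p_d^{\,n/d}.$$ *)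

theory Defs
  imports
    Complex_Main
    "HOL-Library.Poly_Mapping"
    "HOL-Library.Function_Algebras"
    "HOL-Computational_Algebra.Squarefree"
    "HOL-Combinatorics.Orbits"
    "HOL-Algebra.Sym_Groups"
begin

section \<open>Formal power series in variables indexed by the natural numbers\<close>

text \<open>
  A monomial is a finitely supported exponent vector. The ring of symmetric functions is a
  subring of the following ring, so identities between symmetric functions can be stated here.
\<close>

typedef 'a mpser = "UNIV :: ((nat \<Rightarrow>\<^sub>0 nat) \<Rightarrow> 'a) set"
  morphisms mcoeff Abs_mpser
  by simp

lemma mcoeff_Abs [simp]: "mcoeff (Abs_mpser f) = f"
  by (simp add: Abs_mpser_inverse)

lemma mpser_eqI: "(\<And>m. mcoeff f m = mcoeff g m) \<Longrightarrow> f = g"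
  by (metis ext mcoeff_inject)

definition splits :: "(nat \<Rightarrow>\<^sub>0 nat) \<Rightarrow> ((nat \<Rightarrow>\<^sub>0 nat) \<times> (nat \<Rightarrow>\<^sub>0 nat)) set"
  where "splits m = {(a, b). a + b = m}"

lemma finite_splits [simp]: "finite (splits m)"
proof -
  let ?lk = "Poly_Mapping.lookup :: (nat \<Rightarrow>\<^sub>0 nat) \<Rightarrow> nat \<Rightarrow> nat"
  define M where "M = (\<Sum>k\<in>Poly_Mapping.keys m. ?lk m k)"
  let ?F = "{f. (\<forall>k. (k \<in> Poly_Mapping.keys m \<longrightarrow> f k \<in> {..M}) \<and>
                      (k \<notin> Poly_Mapping.keys m \<longrightarrow> f k = 0))}"
  have fin: "finite ?F"
    by (rule finite_set_of_finite_funs) auto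
  have "(\<lambda>p. ?lk (fst p)) ` splits m \<subseteq> ?F"
  proof (rule image_subsetI)
    fix p assume "p \<in> splits m"
    then have m: "m = fst p + snd p" by (auto simp: splits_def)
    have le: "?lk (fst p) k \<le> ?lk m k" for k
      by (simp add: m lookup_add)
    have le_M: "?lk m k \<le> M" if "k \<in> Poly_Mapping.keys m" for k
      unfolding M_def using that by (intro member_le_sum) auto
    have "?lk (fst p) k = 0" if "k \<notin> Poly_Mapping.keys m" for k
      using le[of k] that by (simp add: in_keys_iff)
    with le_trans[OF le le_M] show "?lk (fst p) \<in> ?F"
      by simp
  qed
  moreover have "inj_on (\<lambda>p. ?lk (fst p)) (splits m)"
    by (auto simp: inj_on_def splits_def lookup_inject)
  ultimately show ?thesis
    using fin finite_subset finite_imageD by blast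
qed

instantiation mpser :: (comm_ring_1) comm_ring_1
begin

definition "0 = Abs_mpser (\<lambda>_. 0)"
definition "1 = Abs_mpser (\<lambda>m. if m = 0 then 1 else 0)"
definition "f + g = Abs_mpser (\<lambda>m. mcoeff f m + mcoeff g m)"
definition "- f = Abs_mpser (\<lambda>m. - mcoeff f m)"
definition "f - g = Abs_mpser (\<lambda>m. mcoeff f m - mcoeff g m)"
definition "f * g = Abs_mpser (\<lambda>m. \<Sum>(a, b)\<in>splits m. mcoeff f a * mcoeff g b)"

instance
proof
  fix f g h :: "'a mpser"
  show "f * g * h = f * (g * h)"
  proof (rule mpser_eqI)
    fix m
    have "mcoeff (f * g * h) m = (\<Sum>(p, q)\<in>Sigma (splits m) (\<lambda>p. splits (fst p)).
        mcoeff f (fst q) * mcoeff g (snd q) * mcoeff h (snd p))"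
      by (simp add: times_mpser_def case_prod_unfold sum_distrib_right sum.Sigma)
    also have "\<dots> = (\<Sum>(p, q)\<in>Sigma (splits m) (\<lambda>p. splits (snd p)).
        mcoeff f (fst p) * mcoeff g (fst q) * mcoeff h (snd q))"
      by (rule sum.reindex_bij_witness
            [where i = "\<lambda>((a, _), (c, d)). ((a + c, d), (a, c))"
               and j = "\<lambda>((_, b), (c, d)). ((c, d + b), (d, b))"])
         (auto simp: splits_def add.assoc)
    also have "\<dots> = mcoeff (f * (g * h)) m"
      by (simp add: times_mpser_def case_prod_unfold sum_distrib_left sum.Sigma mult.assoc)
    finally show "mcoeff (f * g * h) m = mcoeff (f * (g * h)) m" .
  qed
  show "f * g = g * f"
  proof (rule mpser_eqI)
    fix m
    show "mcoeff (f * g) m = mcoeff (g * f) m"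
      unfolding times_mpser_def mcoeff_Abs
      by (rule sum.reindex_bij_witness[where i = prod.swap and j = prod.swap])
         (auto simp: splits_def add.commute mult.commute)
  qed
  show "1 * f = f"
  proof (rule mpser_eqI)
    fix m
    have "mcoeff (1 * f) m = (\<Sum>p\<in>splits m. (if fst p = 0 then 1 else 0) * mcoeff f (snd p))"
      by (simp add: times_mpser_def one_mpser_def case_prod_unfold)
    also have "\<dots> = (\<Sum>p\<in>{(0 :: nat \<Rightarrow>\<^sub>0 nat, m)}. (if fst p = 0 then 1 else 0) * mcoeff f (snd p))"
      by (rule sum.mono_neutral_right[OF finite_splits]) (auto simp: splits_def)
    also have "\<dots> = mcoeff f m"
      by simp
    finally show "mcoeff (1 * f) m = mcoeff f m" .
  qed
  show "(f + g) * h = f * h + g * h"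
    by (rule mpser_eqI)
       (simp add: times_mpser_def plus_mpser_def case_prod_unfold distrib_right sum.distrib)
  show "(0 :: 'a mpser) \<noteq> 1"
  proof
    assume "(0 :: 'a mpser) = 1"
    then have "mcoeff (0 :: 'a mpser) 0 = mcoeff 1 0" by (rule arg_cong)
    then show False by (simp add: zero_mpser_def one_mpser_def)
  qed
qed (rule mpser_eqI;
    simp add: plus_mpser_def minus_mpser_def zero_mpser_def uminus_mpser_def algebra_simps)+

end

definition mscale :: "'a \<Rightarrow> 'a::comm_ring_1 mpser \<Rightarrow> 'a mpser"
  where "mscale c f = Abs_mpser (\<lambda>m. c * mcoeff f m)"

text \<open>The sum of the \<open>x\<^sub>i\<^sup>d\<close> over all \<open>i\<close>; only meaningful for \<open>d > 0\<close>.\<close>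

definition powsum :: "nat \<Rightarrow> complex mpser"
  where "powsum d = Abs_mpser (\<lambda>m. if \<exists>i. m = Poly_Mapping.single i d then 1 else 0)"


section \<open>Induced modules and the Frobenius characteristic\<close>

definition fscale :: "complex \<Rightarrow> ('g \<Rightarrow> complex) \<Rightarrow> 'g \<Rightarrow> complex"
  where "fscale c f = (\<lambda>x. c * f x)"

text \<open>
  Trace of a linear operator \<open>A\<close> on a finite-dimensional subspace \<open>W\<close> invariant under \<open>A\<close>:
  the sum of the diagonal entries of its matrix in a basis of \<open>W\<close>.
\<close>

definition trace_on :: "('g \<Rightarrow> complex) set \<Rightarrow> (('g \<Rightarrow> complex) \<Rightarrow> ('g \<Rightarrow> complex)) \<Rightarrow> complex"
  where "trace_on W A =
    (let B = (SOME B. \<not> module.dependent fscale B \<and> module.span fscale B = W)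
     in \<Sum>b\<in>B. module.representation fscale B (A b) b)"

text \<open>
  For a subgroup \<open>H\<close> of \<open>G\<close> and a one-dimensional \<open>H\<close>-module, namely the complex numbers with
  \<open>h\<close> acting as multiplication by \<open>\<theta> h\<close>, the induced module is realised as the space of
  \<open>H\<close>-equivariant functions on \<open>G\<close>, on which \<open>G\<close> acts by right translation. Functions are
  required to vanish outside the carrier of \<open>G\<close>.
\<close>

definition ind_space :: "('g, 'z) monoid_scheme \<Rightarrow> 'g set \<Rightarrow> ('g \<Rightarrow> complex) \<Rightarrow> ('g \<Rightarrow> complex) set"
  where "ind_space G H \<theta> =
    {f. (\<forall>x. x \<notin> carrier G \<longrightarrow> f x = 0) \<and>
        (\<forall>h\<in>H. \<forall>x\<in>carrier G. f (h \<otimes>\<^bsub>G\<^esub> x) = \<theta> h * f x)}"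

definition ind_act :: "('g, 'z) monoid_scheme \<Rightarrow> 'g \<Rightarrow> ('g \<Rightarrow> complex) \<Rightarrow> 'g \<Rightarrow> complex"
  where "ind_act G g f = (\<lambda>x. if x \<in> carrier G then f (x \<otimes>\<^bsub>G\<^esub> g) else 0)"

definition ind_character ::
    "('g, 'z) monoid_scheme \<Rightarrow> 'g set \<Rightarrow> ('g \<Rightarrow> complex) \<Rightarrow> 'g \<Rightarrow> complex"
  where "ind_character G H \<theta> g = trace_on (ind_space G H \<theta>) (ind_act G g)"

text \<open>The product of \<open>powsum k\<close> over the cycle lengths \<open>k\<close> of \<open>w\<close>, fixed points included.\<close>

definition powsum_cycle_type :: "nat \<Rightarrow> (nat \<Rightarrow> nat) \<Rightarrow> complex mpser"
  where "powsum_cycle_type n w = (\<Prod>C \<in> Orbits.orbit w ` {1..n}. powsum (card C))"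

definition frobenius_char :: "nat \<Rightarrow> ((nat \<Rightarrow> nat) \<Rightarrow> complex) \<Rightarrow> complex mpser"
  where "frobenius_char n \<chi> =
    mscale (1 / fact n) (\<Sum>w\<in>carrier (sym_group n). mscale (\<chi> w) (powsum_cycle_type n w))"


section \<open>The symmetric functions of the statement\<close>

definition long_cycle :: "nat \<Rightarrow> nat \<Rightarrow> nat"
  where "long_cycle n = cycle_of_list [1..<Suc n]"

definition cyc_group :: "nat \<Rightarrow> (nat \<Rightarrow> nat) set"
  where "cyc_group n = generate (sym_group n) {long_cycle n}"

text \<open>
  The scalar by which an element of the cyclic group acts on \<open>V\<^sub>r\<close>: the \<open>k\<close>-th power of the
  long cycle acts by the \<open>k\<close>-th power of \<open>exp (2 \<pi> i r / n)\<close>, independently of the choice of \<open>k\<close>.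
\<close>

definition cyc_scalar :: "nat \<Rightarrow> int \<Rightarrow> (nat \<Rightarrow> nat) \<Rightarrow> complex"
  where "cyc_scalar n r \<sigma> =
    exp (2 * of_real pi * \<i> * of_int r / of_nat n) ^ (LEAST k. \<sigma> = long_cycle n ^^ k)"

definition ell :: "nat \<Rightarrow> int \<Rightarrow> complex mpser"
  where "ell n r = frobenius_char n (ind_character (sym_group n) (cyc_group n) (cyc_scalar n r))"

definition pos_divisors :: "nat \<Rightarrow> nat set"
  where "pos_divisors m = {d. 0 < d \<and> d dvd m}"

definition moebius :: "nat \<Rightarrow> int"
  where "moebius m = (if squarefree m then (-1) ^ card (prime_factors m) else 0)"

definition psi :: "nat set \<Rightarrow> nat \<Rightarrow> int"
  where "psi T d = (\<Sum>e\<in>pos_divisors d \<inter> T. int e * moebius (d div e))"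

definition fT :: "nat set \<Rightarrow> nat \<Rightarrow> complex mpser"
  where "fT T n = mscale (1 / of_nat n)
    (\<Sum>d\<in>pos_divisors n. mscale (of_int (psi T d)) (powsum d ^ (n div d)))"

definition F_plus :: "nat \<Rightarrow> complex mpser set"
  where "F_plus n =
    {\<Sum>e\<in>pos_divisors n. mscale (of_real (b e)) (ell n (int e)) | b :: nat \<Rightarrow> real.
      \<forall>e\<in>pos_divisors n. 0 \<le> b e}"

end

theory Submission
  imports
    Defs
    "HOL-Library.Real_Mod"
    "HOL-Number_Theory.Cong"
    "HOL-Algebra.Multiplicative_Group"
begin

text \<open>
  Write \<open>D(r)\<close> for the set of positive divisors of \<open>r\<close>. Everything rests on the identity
  \<open>\<ell>\<^sub>n\<^sup>(\<^sup>r\<^sup>) = f\<^sub>n\<^sup>T\<close> with \<open>T = D(r)\<close> (\<open>ell_eq_fT\<close>). To see it, compute the induced character as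
  an average of the inducing character over conjugates (\<open>ind_character_formula\<close>); the Frobenius
  characteristic then collapses to an average over the cyclic group alone (\<open>frobenius_char_induced\<close>).
  The \<open>k\<close>-th power of the long cycle splits into cycles of equal length \<open>n / gcd(n, k)\<close>, so the
  coefficient of \<open>p\<^sub>d\<^sup>n\<^sup>/\<^sup>d\<close> is, up to the factor \<open>1/n\<close>, the Ramanujan sum of the powers of
  \<open>exp(2 \<pi> i r / n)\<close> over all \<open>k\<close> with \<open>n / gcd(n, k) = d\<close>. Both this sum and \<open>\<psi>\<^sup>T(d)\<close> with
  \<open>T = D(r)\<close> have the divisor sums \<open>m [m \<in> D(r)]\<close>, so they agree (\<open>ramanujan_sum_eq_psi\<close>).

  Since \<open>f\<^sub>n\<^sup>T\<close> depends only on \<open>T \<inter> D(n)\<close>, condition (ii) gives (iii), and (iii) gives (i) by choosing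
  the coefficients 0 or a unit vector. The substance is the step from (i) to (ii). If
  \<open>f\<^sub>n\<^sup>T = \<Sum>\<^sub>e b\<^sub>e \<ell>\<^sub>n\<^sup>(\<^sup>e\<^sup>)\<close>, then, the products \<open>p\<^sub>d\<^sup>n\<^sup>/\<^sup>d\<close> being linearly independent
  (\<open>powsum_powers_independent\<close>), one may compare coefficients; taking divisor sums turns the
  comparison into the statement that, for every \<open>m\<close> dividing \<open>n\<close>, the indicator
  \<open>[m \<in> T]\<close> is the sum of the \<open>b\<^sub>e\<close> with \<open>m dvd e\<close>. With \<open>b \<ge> 0\<close> this forces the
  shape of \<open>T\<close> (\<open>nonneg_indicator_combination\<close>): the case \<open>m = 1\<close> says that all the \<open>b\<^sub>e\<close> together weigh
  at most 1. If some \<open>b\<^sub>r\<close> is positive, the divisors of \<open>r\<close> have positive sum and lie in \<open>T\<close>, while an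
  \<open>m \<in> T\<close> must already collect the whole weight, which it can only do if it divides \<open>r\<close>.
\<close>

section \<open>Divisor sums\<close>

lemma finite_pos_divisors [simp]: "0 < n \<Longrightarrow> finite (pos_divisors n)"
  by (rule finite_subset[of _ "{..n}"]) (auto simp: pos_divisors_def dest: dvd_imp_le)

lemma pos_divisors_positive:
  "0 < n \<Longrightarrow> pos_divisors n = {d. d dvd n}"
  by (auto simp: pos_divisors_def intro: Nat.gr0I)

lemma moebius_prime_mult:
  fixes p d :: nat
  assumes p: "prime p" and pd: "\<not> p dvd d"
  shows "moebius (p * d) = - moebius d"
proof -
  have d0: "d \<noteq> 0" using pd by (metis dvd_0_right)
  have cop: "coprime p d" using p pd by (simp add: prime_imp_coprime)
  have sf: "squarefree (p * d) \<longleftrightarrow> squarefree d"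
    using squarefree_mult_coprime[OF cop] squarefree_prime[OF p] squarefree_multD by blast
  have "prime_factors (p * d) = insert p (prime_factors d)"
    using p d0 by (simp add: prime_factors_product prime_prime_factors)
  moreover have "p \<notin> prime_factors d"
    using pd by auto
  ultimately show ?thesis
    by (simp add: moebius_def sf)
qed

text \<open>
  For a prime \<open>p\<close> dividing \<open>n\<close>, multiplication by \<open>p\<close> pairs the divisors prime to \<open>p\<close> with divisors of the
  opposite sign; the divisors left over are multiples of the square of \<open>p\<close> and contribute nothing.
\<close>

lemma sum_moebius_divisors:
  assumes n: "0 < n"
  shows "(\<Sum>d\<in>pos_divisors n. moebius d) = (if n = 1 then 1 else 0)"
proof (cases "n = 1")
  case True
  then have "pos_divisors n = {1}" by (auto simp: pos_divisors_def)
  then show ?thesis using True by (simp add: moebius_def)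
next
  case False
  then obtain p where p: "prime p" "p dvd n" using prime_factor_nat by blast
  let ?D = "pos_divisors n"
  let ?A = "{d\<in>?D. \<not> p dvd d}"
  let ?B = "{d\<in>?D. p dvd d}"
  have inj: "inj_on ((*) p) ?A"
    using p prime_gt_0_nat by (auto simp: inj_on_def)
  have sub: "(*) p ` ?A \<subseteq> ?B"
    using p n by (auto simp: pos_divisors_positive prime_imp_coprime intro!: divides_mult)
  \<comment> \<open>Only the multiples of \<open>p\<close> divisible by its square are lost.\<close>
  have "sum moebius ?B = sum moebius ((*) p ` ?A)"
  proof (rule sum.mono_neutral_right)
    show "\<forall>d\<in>?B - (*) p ` ?A. moebius d = 0"
    proof
      fix d assume d: "d \<in> ?B - (*) p ` ?A"
      then obtain e where e: "d = p * e" by (auto simp: dvd_def)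
      have "e dvd n" using d e n by (auto simp: pos_divisors_positive intro: dvd_trans)
      with d e n have "p dvd e" by (auto simp: pos_divisors_positive)
      then have "p\<^sup>2 dvd d" by (simp add: e power2_eq_square)
      then have "\<not> squarefree d" using p
        by (metis not_squarefreeI not_prime_unit)
      then show "moebius d = 0" by (simp add: moebius_def)
    qed
  qed (use sub n in auto)
  also have "\<dots> = (\<Sum>d\<in>?A. moebius (p * d))"
    by (simp add: sum.reindex[OF inj])
  also have "\<dots> = - sum moebius ?A"
    using p by (simp add: moebius_prime_mult sum_negf)
  finally have "sum moebius ?A + sum moebius ?B = 0" by simp
  moreover have "sum moebius ?D = sum moebius ?A + sum moebius ?B"
    using n by (subst sum.union_disjoint[symmetric]) (auto intro: sum.cong)
  ultimately show ?thesis using False by simp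
qed

text \<open>
  Moebius inversion: \<open>\<psi>\<^sup>T\<close> is the Dirichlet convolution of \<open>\<mu>\<close> with \<open>m [m \<in> T]\<close>, and summing over divisors
  undoes the convolution with \<open>\<mu>\<close>.
\<close>

lemma sum_psi_divisors:
  assumes m: "0 < m"
  shows "(\<Sum>d\<in>pos_divisors m. psi T d) = (if m \<in> T then int m else 0)"
proof -
  have "(\<Sum>d\<in>pos_divisors m. psi T d)
      = (\<Sum>(d, e)\<in>Sigma (pos_divisors m) (\<lambda>d. pos_divisors d \<inter> T). int e * moebius (d div e))"
    unfolding psi_def by (subst sum.Sigma) (use m in \<open>auto simp: pos_divisors_def\<close>)
  also have "\<dots> = (\<Sum>(e, k)\<in>Sigma (pos_divisors m \<inter> T) (\<lambda>e. pos_divisors (m div e)). int e * moebius k)"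
  proof (rule sum.reindex_bij_witness
      [where i = "\<lambda>(e, k). (e * k, e)" and j = "\<lambda>(d, e). (e, d div e)"])
    fix p assume "p \<in> Sigma (pos_divisors m) (\<lambda>d. pos_divisors d \<inter> T)"
    then obtain e k where p: "p = (e * k, e)" "0 < e" "0 < k" "e * k dvd m" "e \<in> T"
      by (auto simp: pos_divisors_def elim!: dvdE)
    then have "k dvd m div e" "e dvd m"
      by (auto simp: dvd_div_iff_mult mult.commute intro: dvd_mult_left)
    with p show "(case p of (d, e) \<Rightarrow> (e, d div e)) \<in> Sigma (pos_divisors m \<inter> T) (\<lambda>e. pos_divisors (m div e))"
      "(case case p of (d, e) \<Rightarrow> (e, d div e) of (e, k) \<Rightarrow> (e * k, e)) = p"
      "(case case p of (d, e) \<Rightarrow> (e, d div e) of (e, k) \<Rightarrow> int e * moebius k) =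
         (case p of (d, e) \<Rightarrow> int e * moebius (d div e))"
      by (auto simp: pos_divisors_def)
  next
    fix p assume "p \<in> Sigma (pos_divisors m \<inter> T) (\<lambda>e. pos_divisors (m div e))"
    then obtain e k where p: "p = (e, k)" "0 < e" "0 < k" "e dvd m" "k dvd m div e" "e \<in> T"
      by (auto simp: pos_divisors_def)
    then have "e * k dvd m"
      by (simp add: dvd_div_iff_mult mult.commute)
    with p show "(case p of (e, k) \<Rightarrow> (e * k, e)) \<in> Sigma (pos_divisors m) (\<lambda>d. pos_divisors d \<inter> T)"
      "(case case p of (e, k) \<Rightarrow> (e * k, e) of (d, e) \<Rightarrow> (e, d div e)) = p"
      by (auto simp: pos_divisors_def)
  qed
  also have "\<dots> = (\<Sum>e\<in>pos_divisors m \<inter> T. int e * (\<Sum>k\<in>pos_divisors (m div e). moebius k))"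
    by (subst sum.Sigma[symmetric])
       (use m in \<open>auto simp: sum_distrib_left pos_divisors_def dvd_div_eq_0_iff
          intro!: finite_pos_divisors[unfolded pos_divisors_def]\<close>)
  also have "\<dots> = (\<Sum>e\<in>pos_divisors m \<inter> T. if e = m then int m else 0)"
  proof (rule sum.cong[OF refl])
    fix e assume e: "e \<in> pos_divisors m \<inter> T"
    then have "m div e > 0" using m by (auto simp: pos_divisors_def dvd_div_eq_0_iff intro!: Nat.gr0I)
    moreover have "m div e = 1 \<longleftrightarrow> e = m"
      using e m by (auto simp: pos_divisors_def)
    ultimately show "int e * (\<Sum>k\<in>pos_divisors (m div e). moebius k) = (if e = m then int m else 0)"
      by (simp add: sum_moebius_divisors)
  qed
  also have "\<dots> = (if m \<in> T then int m else 0)"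
    using m by (simp add: sum.delta) (simp add: pos_divisors_def)
  finally show ?thesis .
qed

text \<open>
  Passing to divisor sums is a unitriangular operation with respect to divisibility, hence injective.
  Two arithmetic functions can therefore be compared through divisor sums that are easier to compute.
\<close>

lemma divisor_sums_determine:
  fixes f g :: "nat \<Rightarrow> 'a::ab_group_add"
  assumes eq: "\<And>m. m \<in> pos_divisors n \<Longrightarrow> sum f (pos_divisors m) = sum g (pos_divisors m)"
  assumes "d \<in> pos_divisors n"
  shows "f d = g d"
  using assms(2)
proof (induction d rule: less_induct)
  case (less d)
  then have d: "0 < d" "d dvd n" by (auto simp: pos_divisors_def)
  have split: "sum h (pos_divisors d) = h d + sum h (pos_divisors d - {d})" for h :: "nat \<Rightarrow> 'a"
    using d by (intro sum.remove) (auto simp: pos_divisors_def intro: finite_pos_divisors[unfolded pos_divisors_def])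
  have "f e = g e" if "e \<in> pos_divisors d - {d}" for e
  proof (rule less.IH)
    show "e < d" "e \<in> pos_divisors n"
      using that d by (auto simp: pos_divisors_def intro: dvd_trans dest: dvd_imp_le)
  qed
  then have "sum f (pos_divisors d - {d}) = sum g (pos_divisors d - {d})"
    by (rule sum.cong[OF refl])
  with eq[OF less.prems] show ?case
    by (simp add: split)
qed

text \<open>
  The combinatorial core. The weights \<open>b e\<close> with \<open>m dvd e\<close> sum to 0 or 1, and for \<open>m = 1\<close> these are all the
  weights. An \<open>r\<close> of positive weight is seen by each of its divisors, so these lie in \<open>T\<close>; and an
  \<open>m \<in> T\<close> not dividing \<open>r\<close> would miss the weight of \<open>r\<close> and stay strictly below the total 1.
\<close>

lemma nonneg_indicator_combination:
  fixes b :: "nat \<Rightarrow> real"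
  assumes n: "0 < n" and b: "\<And>e. e \<in> pos_divisors n \<Longrightarrow> 0 \<le> b e"
    and eq: "\<And>m. m \<in> pos_divisors n \<Longrightarrow>
      (if m \<in> T then 1 else 0) = (\<Sum>e | e \<in> pos_divisors n \<and> m dvd e. b e)"
  shows "T \<inter> pos_divisors n = {} \<or> (\<exists>r. r dvd n \<and> T \<inter> pos_divisors n = pos_divisors r)"
proof (rule disjCI)
  assume ne: "\<not> (\<exists>r. r dvd n \<and> T \<inter> pos_divisors n = pos_divisors r)"
  let ?D = "pos_divisors n"
  have one: "(if 1 \<in> T then 1 else 0) = (\<Sum>e\<in>?D. b e)"
    using eq[of 1] n by (simp add: pos_divisors_def)
  \<comment> \<open>A positive weight would make \<open>T\<close> a divisor set, so excluding divisor sets leaves only the zero weights.\<close>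
  have all0: "\<forall>e\<in>?D. b e = 0"
  proof (rule ccontr)
    assume "\<not> (\<forall>e\<in>?D. b e = 0)"
    then obtain r where r: "r \<in> ?D" "b r > 0" using b by force
    have pos: "(\<Sum>e | e \<in> ?D \<and> m dvd e. b e) > 0" if "m dvd r" for m
      using r that n b by (intro sum_pos2[of _ r]) auto
    have mem: "m \<in> T" if "m dvd r" for m
      using eq[of m] pos[OF that] that r
      by (auto simp: pos_divisors_positive[OF n] split: if_splits intro: dvd_trans)
    have "m dvd r" if m: "m \<in> T \<inter> ?D" for m
    proof (rule ccontr)
      assume nd: "\<not> m dvd r"
      have "(\<Sum>e | e \<in> ?D \<and> m dvd e. b e) < (\<Sum>e\<in>?D. b e)"
        using n r nd b by (intro sum_strict_mono2[of _ _ r]) auto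
      with one eq[of m] m mem[of 1] show False by auto
    qed
    with mem r n have "T \<inter> ?D = pos_divisors r"
      by (auto simp: pos_divisors_positive pos_divisors_def intro: dvd_trans)
    with ne r n show False by (auto simp: pos_divisors_positive)
  qed
  show "T \<inter> ?D = {}"
    using eq all0 by (force split: if_splits)
qed

section \<open>Products of power sums\<close>

lemma mcoeff_zero [simp]: "mcoeff 0 m = 0"
  by (simp add: zero_mpser_def)
lemma mcoeff_add [simp]: "mcoeff (f + g) m = mcoeff f m + mcoeff g m"
  by (simp add: plus_mpser_def)
lemma mcoeff_mscale [simp]: "mcoeff (mscale c f) m = c * mcoeff f m"
  by (simp add: mscale_def)
lemma mcoeff_sum [simp]: "mcoeff (sum f A) m = (\<Sum>a\<in>A. mcoeff (f a) m)"
  by (induction A rule: infinite_finite_induct) auto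
lemma mscale_mscale [simp]: "mscale a (mscale b f) = mscale (a * b) f"
  by (rule mpser_eqI) simp
lemma mscale_one [simp]: "mscale 1 f = f"
  by (rule mpser_eqI) simp
lemma mscale_zero_left [simp]: "mscale 0 f = 0"
  by (rule mpser_eqI) simp
lemma mscale_sum_right: "mscale c (sum f A) = (\<Sum>a\<in>A. mscale c (f a))"
  by (rule mpser_eqI) (simp add: sum_distrib_left)
lemma mscale_sum_left: "mscale (sum c A) f = (\<Sum>a\<in>A. mscale (c a) f)"
  by (rule mpser_eqI) (simp add: sum_distrib_right)

lemma powsum_power_exponents:
  assumes "mcoeff (powsum d ^ k) m \<noteq> 0"
  shows "d dvd Poly_Mapping.lookup m i"
  using assms
proof (induction k arbitrary: m)
  case 0
  then have "m = 0" by (auto simp: one_mpser_def split: if_splits)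
  then show ?case by simp
next
  case (Suc k)
  then have "(\<Sum>(a, b)\<in>splits m. mcoeff (powsum d) a * mcoeff (powsum d ^ k) b) \<noteq> 0"
    by (simp add: times_mpser_def)
  then obtain a b where ab: "m = a + b" "mcoeff (powsum d) a \<noteq> 0" "mcoeff (powsum d ^ k) b \<noteq> 0"
    by (auto simp: splits_def elim!: sum.not_neutral_contains_not_neutral)
  from ab(2) obtain j where "a = Poly_Mapping.single j d"
    by (auto simp: powsum_def split: if_splits)
  then have "d dvd Poly_Mapping.lookup a i"
    by (simp add: lookup_single when_def)
  with Suc.IH[OF ab(3)] ab(1) show ?case
    by (simp add: lookup_add)
qed

text \<open>
  The monomial \<open>x\<^sub>0\<^sup>d \<cdots> x\<^sub>k\<^sub>-\<^sub>1\<^sup>d\<close> occurs in the \<open>k\<close>-th power of \<open>p\<^sub>d\<close>. For \<open>d > 0\<close> its coefficient is \<open>k!\<close>,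
  but it is enough that all coefficients are natural numbers and so cannot cancel: a single positive
  contribution to this coefficient makes it positive.
\<close>

lemma powsum_power_leading:
  "\<exists>c :: _ \<Rightarrow> nat. (\<forall>m. mcoeff (powsum d ^ k) m = of_nat (c m)) \<and>
     c (\<Sum>i<k. Poly_Mapping.single i d) > 0"
proof (induction k)
  case 0
  show ?case
    by (rule exI[of _ "\<lambda>m. if m = 0 then 1 else 0"]) (simp add: one_mpser_def)
next
  case (Suc k)
  then obtain c where c: "\<And>m. mcoeff (powsum d ^ k) m = of_nat (c m)"
    "c (\<Sum>i<k. Poly_Mapping.single i d) > 0" by blast
  define u :: "(nat \<Rightarrow>\<^sub>0 nat) \<Rightarrow> nat" where
    "u = (\<lambda>m. if \<exists>i. m = Poly_Mapping.single i d then 1 else 0)"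
  let ?c = "\<lambda>m. \<Sum>(a, b)\<in>splits m. u a * c b"
  have u: "mcoeff (powsum d) m = of_nat (u m)" for m
    by (simp add: powsum_def u_def)
  have "mcoeff (powsum d ^ Suc k) m = of_nat (?c m)" for m
    by (simp add: times_mpser_def c(1) u case_prod_unfold)
  moreover have "?c (\<Sum>i<Suc k. Poly_Mapping.single i d) > 0"
    using c(2)
    by (intro sum_pos2[of _ "(Poly_Mapping.single k d, \<Sum>i<k. Poly_Mapping.single i d)"])
       (auto simp: u_def add.commute, auto simp: splits_def add.commute)
  ultimately show ?case
    by (intro exI[of _ ?c] conjI allI)
qed

text \<open>
  Triangularity with respect to divisibility: the monomial \<open>x\<^sub>0\<^sup>d \<cdots> x\<^sub>k\<^sub>-\<^sub>1\<^sup>d\<close> with \<open>k = n / d\<close> occurs in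
  \<open>p\<^sub>d\<^sup>n\<^sup>/\<^sup>d\<close>, and it occurs in \<open>p\<^sub>e\<^sup>n\<^sup>/\<^sup>e\<close> only if \<open>e\<close> divides \<open>d\<close>. Induction on \<open>d\<close> disposes of the proper divisors.
\<close>

lemma powsum_powers_independent:
  assumes n: "0 < n" and eq: "(\<Sum>d\<in>pos_divisors n. mscale (a d) (powsum d ^ (n div d))) = 0"
    and d: "d \<in> pos_divisors n"
  shows "a d = 0"
  using d
proof (induction d rule: less_induct)
  case (less d)
  let ?D = "pos_divisors n"
  from less.prems n have d: "0 < d" "d dvd n" "0 < n div d"
    by (auto simp: pos_divisors_def dvd_div_eq_0_iff intro!: Nat.gr0I)
  let ?M = "\<Sum>i<n div d. Poly_Mapping.single i d :: nat \<Rightarrow>\<^sub>0 nat"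
  have look: "Poly_Mapping.lookup ?M 0 = d"
    using d by (simp add: lookup_sum lookup_single when_def)
  \<comment> \<open>The exponent \<open>d\<close> of the first variable leaves only the divisors of \<open>d\<close>, and the proper ones are settled.\<close>
  have vanish: "a e * mcoeff (powsum e ^ (n div e)) ?M = 0" if e: "e \<in> ?D - {d}" for e
  proof (cases "mcoeff (powsum e ^ (n div e)) ?M = 0")
    case False
    then have "e dvd d" using powsum_power_exponents[of e _ ?M 0] look by simp
    with e d have "e < d" by (auto dest: dvd_imp_le)
    with less.IH e show ?thesis by simp
  qed simp
  have "0 = mcoeff (\<Sum>d\<in>?D. mscale (a d) (powsum d ^ (n div d))) ?M"
    by (simp only: eq mcoeff_zero)
  also have "\<dots> = (\<Sum>e\<in>?D. a e * mcoeff (powsum e ^ (n div e)) ?M)"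
    by simp
  also have "\<dots> = a d * mcoeff (powsum d ^ (n div d)) ?M
      + (\<Sum>e\<in>?D - {d}. a e * mcoeff (powsum e ^ (n div e)) ?M)"
    using n less.prems by (intro sum.remove) auto
  also have "(\<Sum>e\<in>?D - {d}. a e * mcoeff (powsum e ^ (n div e)) ?M) = 0"
    by (intro sum.neutral) (use vanish in blast)
  finally have "a d * mcoeff (powsum d ^ (n div d)) ?M = 0" by simp
  moreover obtain c where "mcoeff (powsum d ^ (n div d)) ?M = of_nat (c ?M)" "c ?M > 0"
    using powsum_power_leading[of d "n div d"] by blast
  ultimately show ?case by auto
qed

section \<open>Traces and induced characters\<close>

global_interpretation fun_space: vector_space "fscale :: complex \<Rightarrow> ('g \<Rightarrow> complex) \<Rightarrow> 'g \<Rightarrow> complex"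
  by unfold_locales (auto simp: fscale_def fun_eq_iff algebra_simps)

lemma sum_fun_apply: "(\<Sum>i\<in>I. F i) x = (\<Sum>i\<in>I. (F i x :: 'a::comm_monoid_add))"
  by (induction I rule: infinite_finite_induct) auto

text \<open>
  A trace in terms of an unspecified basis can be evaluated without choosing one. By assumption
  \<open>f \<mapsto> \<Sum>\<^sub>x f(x) q x\<close> is a projection onto \<open>W\<close> that carries the delta function at \<open>x\<close> to \<open>q x\<close>; the \<open>q x\<close> span
  \<open>W\<close> but need not be independent. If \<open>\<sigma>\<close> maps \<open>X\<close> to itself, the trace of \<open>A\<close> on \<open>W\<close> is the trace, on the
  space of all functions on \<open>X\<close>, of the projection followed by substitution of \<open>\<sigma>\<close>, and the diagonal
  entries of that operator in the basis of delta functions are the values \<open>q x (\<sigma> x)\<close>. The proof expands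
  each \<open>A b\<close> in the \<open>q x\<close> and exchanges the sums over \<open>b\<close> and \<open>x\<close>.
\<close>

lemma trace_on_substitution:
  fixes W :: "('g \<Rightarrow> complex) set" and q :: "'g \<Rightarrow> 'g \<Rightarrow> complex"
  assumes X: "finite X" and W: "fun_space.subspace W"
    and q: "\<And>x. x \<in> X \<Longrightarrow> q x \<in> W"
    and recon: "\<And>f. f \<in> W \<Longrightarrow> f = (\<Sum>x\<in>X. fscale (f x) (q x))"
    and A: "\<And>f. f \<in> W \<Longrightarrow> A f \<in> W"
    and A_apply: "\<And>f x. f \<in> W \<Longrightarrow> x \<in> X \<Longrightarrow> A f x = f (\<sigma> x)"
  shows "trace_on W A = (\<Sum>x\<in>X. q x (\<sigma> x))"
proof -
  define B where "B = (SOME B. fun_space.independent B \<and> fun_space.span B = W)"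
  obtain B0 where "B0 \<subseteq> W" "fun_space.independent B0" "W \<subseteq> fun_space.span B0"
    by (rule fun_space.maximal_independent_subset)
  then have "fun_space.independent B0 \<and> fun_space.span B0 = W"
    using fun_space.span_minimal[OF _ W] by blast
  then have B: "fun_space.independent B \<and> fun_space.span B = W"
    unfolding B_def by (rule someI)
  then have ind: "fun_space.independent B" and span: "fun_space.span B = W" by auto
  have BW: "b \<in> W" if "b \<in> B" for b
    using that fun_space.span_base span by blast
  \<comment> \<open>Without finiteness of the basis the sum that defines the trace would default to 0.\<close>
  have "W \<subseteq> fun_space.span (q ` X)"
  proof
    fix f assume "f \<in> W"
    then have "f = (\<Sum>x\<in>X. fscale (f x) (q x))" by (rule recon)
    also have "\<dots> \<in> fun_space.span (q ` X)"
      by (intro fun_space.span_sum fun_space.span_scale fun_space.span_base) auto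
    finally show "f \<in> fun_space.span (q ` X)" .
  qed
  then have fin: "finite B"
    using fun_space.independent_span_bound[OF finite_imageI[OF X] ind] BW by blast
  let ?rep = "fun_space.representation B"
  have rep: "?rep (A b) b = (\<Sum>x\<in>X. b (\<sigma> x) * ?rep (q x) b)" if b: "b \<in> B" for b
  proof -
    have q_span: "q x \<in> fun_space.span B" if "x \<in> X" for x
      using q[OF that] span by simp
    have "A b = (\<Sum>x\<in>X. fscale (b (\<sigma> x)) (q x))"
      using recon[OF A[OF BW[OF b]]] A_apply[OF BW[OF b]] by simp
    then have "?rep (A b) b = (\<Sum>x\<in>X. ?rep (fscale (b (\<sigma> x)) (q x)) b)"
      using q_span by (simp only: fun_space.representation_sum[OF ind] fun_space.span_scale)
    also have "\<dots> = (\<Sum>x\<in>X. b (\<sigma> x) * ?rep (q x) b)"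
      using q_span by (intro sum.cong) (simp_all add: fun_space.representation_scale[OF ind])
    finally show ?thesis .
  qed
  have "trace_on W A = (\<Sum>b\<in>B. ?rep (A b) b)"
    by (simp add: trace_on_def B_def Let_def)
  also have "\<dots> = (\<Sum>b\<in>B. \<Sum>x\<in>X. b (\<sigma> x) * ?rep (q x) b)"
    by (simp add: rep)
  also have "\<dots> = (\<Sum>x\<in>X. \<Sum>b\<in>B. b (\<sigma> x) * ?rep (q x) b)"
    by (rule sum.swap)
  also have "\<dots> = (\<Sum>x\<in>X. q x (\<sigma> x))"
  proof (rule sum.cong[OF refl])
    fix x assume "x \<in> X"
    then have "(\<Sum>b\<in>B. fscale (?rep (q x) b) b) = q x"
      using fun_space.sum_representation_eq[OF ind _ fin subset_refl] q span by blast
    then have "q x (\<sigma> x) = (\<Sum>b\<in>B. fscale (?rep (q x) b) b) (\<sigma> x)" by simp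
    also have "\<dots> = (\<Sum>b\<in>B. b (\<sigma> x) * ?rep (q x) b)"
      by (simp add: sum_fun_apply fscale_def mult.commute)
    finally show "(\<Sum>b\<in>B. b (\<sigma> x) * ?rep (q x) b) = q x (\<sigma> x)" by simp
  qed
  finally show ?thesis .
qed

text \<open>
  The formula of Frobenius for an induced character, in the form that averages over the whole group
  instead of running through coset representatives. The projection of all functions on the group
  onto the equivariant ones is averaging over \<open>H\<close>; applied to the delta function at \<open>x\<close> it gives
  \<open>y \<mapsto> \<theta>(y x\<^sup>-\<^sup>1) / |H|\<close> on the coset \<open>H x\<close>, which is the function \<open>q x\<close> of the proof.
\<close>

lemma ind_character_formula:
  fixes G (structure)
  assumes "group G" and fin: "finite (carrier G)" and H: "subgroup H G"
    and \<theta>: "\<And>h k. h \<in> H \<Longrightarrow> k \<in> H \<Longrightarrow> \<theta> (h \<otimes> k) = \<theta> h * \<theta> k"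
    and g: "g \<in> carrier G"
  shows "ind_character G H \<theta> g =
    (\<Sum>x\<in>carrier G. if x \<otimes> g \<otimes> inv x \<in> H then \<theta> (x \<otimes> g \<otimes> inv x) else 0) / of_nat (card H)"
proof -
  interpret group G by fact
  interpret H: subgroup H G by fact
  let ?W = "ind_space G H \<theta>"
  define q where "q x y = (if y \<in> carrier G \<and> y \<otimes> inv x \<in> H
    then \<theta> (y \<otimes> inv x) / of_nat (card H) else 0)" for x y
  have finH: "finite H" using fin H.subset finite_subset by blast
  then have cardH: "card H \<noteq> 0" using H.one_closed by (metis card_0_eq empty_iff)
  have "ind_character G H \<theta> g = trace_on ?W (ind_act G g)"
    by (simp add: ind_character_def)
  also have "\<dots> = (\<Sum>x\<in>carrier G. q x (x \<otimes> g))"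
  proof (rule trace_on_substitution)
    show "fun_space.subspace ?W"
      by (rule fun_space.subspaceI) (auto simp: ind_space_def fscale_def algebra_simps)
    show "q x \<in> ?W" if x: "x \<in> carrier G" for x
    proof -
      have "q x (h \<otimes> y) = \<theta> h * q x y" if h: "h \<in> H" and y: "y \<in> carrier G" for h y
      proof -
        have hc: "h \<in> carrier G" using h by simp
        have eq: "h \<otimes> y \<otimes> inv x = h \<otimes> (y \<otimes> inv x)" using hc y x by (simp add: m_assoc)
        have "h \<otimes> (y \<otimes> inv x) \<in> H \<longleftrightarrow> y \<otimes> inv x \<in> H"
        proof
          assume "h \<otimes> (y \<otimes> inv x) \<in> H"
          then have "inv h \<otimes> (h \<otimes> (y \<otimes> inv x)) \<in> H" by (rule H.m_closed[OF H.m_inv_closed[OF h]])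
          moreover have "inv h \<otimes> (h \<otimes> (y \<otimes> inv x)) = y \<otimes> inv x"
            using m_assoc[of "inv h" h "y \<otimes> inv x"] hc y x by simp
          ultimately show "y \<otimes> inv x \<in> H" by simp
        qed (use h in \<open>rule H.m_closed\<close>)
        then show ?thesis using h hc y by (simp add: q_def eq \<theta>)
      qed
      then show ?thesis by (auto simp: ind_space_def q_def)
    qed
    show "f = (\<Sum>x\<in>carrier G. fscale (f x) (q x))" if f: "f \<in> ?W" for f
    proof
      fix y
      show "f y = (\<Sum>x\<in>carrier G. fscale (f x) (q x)) y"
      proof (cases "y \<in> carrier G")
        case False
        then show ?thesis using f by (simp add: sum_fun_apply fscale_def q_def ind_space_def)
      next
        case y: True
        have "(\<Sum>x\<in>carrier G. fscale (f x) (q x)) y = (\<Sum>x\<in>carrier G. f x * q x y)"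
          by (simp add: sum_fun_apply fscale_def)
        also have "\<dots> = (\<Sum>x | x \<in> carrier G \<and> y \<otimes> inv x \<in> H. f x * q x y)"
          by (rule sum.mono_neutral_right) (use fin in \<open>auto simp: q_def\<close>)
        also have "\<dots> = (\<Sum>k\<in>H. f y / of_nat (card H))"
        proof (rule sum.reindex_bij_witness[where i = "\<lambda>k. inv k \<otimes> y" and j = "\<lambda>x. y \<otimes> inv x"])
          fix x assume x: "x \<in> {x. x \<in> carrier G \<and> y \<otimes> inv x \<in> H}"
          then have xc: "x \<in> carrier G" by simp
          show "inv (y \<otimes> inv x) \<otimes> y = x" using xc y by (simp add: inv_mult_group m_assoc)
          show "y \<otimes> inv x \<in> H" using x by simp
          have "f (y \<otimes> inv x \<otimes> x) = \<theta> (y \<otimes> inv x) * f x"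
            using f x by (simp add: ind_space_def)
          then show "f y / of_nat (card H) = f x * q x y"
            using x y by (simp add: q_def m_assoc)
        next
          fix k assume k: "k \<in> H"
          then have kc: "k \<in> carrier G" by simp
          show "y \<otimes> inv (inv k \<otimes> y) = k"
            using kc y by (simp add: inv_mult_group m_assoc[symmetric])
          with k kc y show "inv k \<otimes> y \<in> {x. x \<in> carrier G \<and> y \<otimes> inv x \<in> H}" by simp
        qed
        also have "\<dots> = f y" using cardH by simp
        finally show ?thesis by simp
      qed
    qed
    show "ind_act G g f \<in> ?W" if f: "f \<in> ?W" for f
      using f g by (auto simp: ind_space_def ind_act_def m_assoc)
    show "ind_act G g f x = f (x \<otimes> g)" if "x \<in> carrier G" for f x
      using that by (simp add: ind_act_def)
  qed (use fin in auto)
  also have "\<dots> = (\<Sum>x\<in>carrier G. if x \<otimes> g \<otimes> inv x \<in> H then \<theta> (x \<otimes> g \<otimes> inv x) else 0) / of_nat (card H)"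
    unfolding sum_divide_distrib using g by (intro sum.cong) (auto simp: q_def)
  finally show ?thesis .
qed

section \<open>The Frobenius characteristic of a module induced to the symmetric group\<close>

text \<open>
  Conjugation by \<open>p\<close> carries the orbits of \<open>w\<close> to their images under \<open>p\<close>, which have the same sizes.
\<close>

lemma powsum_cycle_type_conjugate:
  assumes p: "p permutes {1..n}"
  shows "powsum_cycle_type n (p \<circ> w \<circ> inv' p) = powsum_cycle_type n w"
proof -
  let ?v = "p \<circ> w \<circ> inv' p"
  have pow: "(?v ^^ m) (p i) = p ((w ^^ m) i)" for m i
    by (induction m) (simp_all add: permutes_inverses[OF p])
  have orb: "orbit ?v (p i) = p ` orbit w i" for i
    by (auto simp: orbit_altdef pow simp del: o_apply)
  have "orbit ?v ` {1..n} = orbit ?v ` (p ` {1..n})"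
    by (simp only: permutes_image[OF p])
  also have "\<dots> = image p ` (orbit w ` {1..n})"
    by (simp only: image_image orb)
  finally have eq: "orbit ?v ` {1..n} = image p ` (orbit w ` {1..n})" .
  have inj: "inj p" by (rule permutes_inj[OF p])
  then have "inj_on (image p) (orbit w ` {1..n})"
    by (simp add: inj_on_def inj_image_eq_iff)
  then show ?thesis
    unfolding powsum_cycle_type_def eq
    by (simp add: prod.reindex card_image[OF inj_on_subset[OF inj subset_UNIV]])
qed

text \<open>
  In the double sum over \<open>w\<close> and the conjugating element \<open>x\<close>, substituting \<open>x\<^sup>-\<^sup>1 v x\<close> for \<open>w\<close> makes the summand
  independent of \<open>x\<close>, since conjugation preserves the cycle type. The sum over \<open>x\<close> then cancels the
  factor \<open>1 / n!\<close>, and only \<open>v \<in> H\<close> contributes.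
\<close>

lemma frobenius_char_induced:
  fixes \<theta> :: "(nat \<Rightarrow> nat) \<Rightarrow> complex"
  assumes H: "subgroup H (sym_group n)"
    and \<theta>: "\<And>h k. h \<in> H \<Longrightarrow> k \<in> H \<Longrightarrow> \<theta> (h \<circ> k) = \<theta> h * \<theta> k"
  shows "frobenius_char n (ind_character (sym_group n) H \<theta>) =
    mscale (1 / of_nat (card H)) (\<Sum>w\<in>H. mscale (\<theta> w) (powsum_cycle_type n w))"
proof -
  let ?G = "sym_group n"
  let ?S = "carrier ?G"
  let ?P = "powsum_cycle_type n"
  interpret group ?G by (rule sym_group_is_group)
  interpret H: subgroup H ?G by fact
  define \<theta>0 where "\<theta>0 v = (if v \<in> H then \<theta> v else 0)" for v
  let ?K = "\<Sum>w\<in>H. mscale (\<theta> w) (?P w)"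
  have S: "?S = {p. p permutes {1..n}}" by (auto simp: sym_group_carrier)
  have fin: "finite ?S" and card: "card ?S = fact n"
    by (simp_all add: S finite_permutations card_permutations)
  have char: "ind_character ?G H \<theta> w = (\<Sum>x\<in>?S. \<theta>0 (x \<circ> w \<circ> inv' x)) / of_nat (card H)"
    if "w \<in> ?S" for w
    using that ind_character_formula[OF sym_group_is_group fin H, of \<theta> w] \<theta>
    by (simp add: sym_group_mult \<theta>0_def cong: if_cong)
  have K: "?K = (\<Sum>v\<in>?S. mscale (\<theta>0 v) (?P v))"
    using fin H.subset by (intro sum.mono_neutral_cong_left) (auto simp: \<theta>0_def)
  have conj: "(\<Sum>w\<in>?S. mscale (\<theta>0 (x \<circ> w \<circ> inv' x)) (?P w)) = ?K" if x: "x \<in> ?S" for x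
    unfolding K
  proof (rule sum.reindex_bij_witness[where i = "\<lambda>v. inv' x \<circ> v \<circ> x" and j = "\<lambda>w. x \<circ> w \<circ> inv' x"])
    have xp: "x permutes {1..n}" using x by (simp add: sym_group_carrier)
    fix w assume w: "w \<in> ?S"
    show "inv' x \<circ> (x \<circ> w \<circ> inv' x) \<circ> x = w" "x \<circ> (inv' x \<circ> w \<circ> x) \<circ> inv' x = w"
      by (simp_all add: fun_eq_iff permutes_inverses[OF xp])
    show "x \<circ> w \<circ> inv' x \<in> ?S" "inv' x \<circ> w \<circ> x \<in> ?S"
      using w xp by (auto simp: S intro!: permutes_compose permutes_inv)
    show "mscale (\<theta>0 (x \<circ> w \<circ> inv' x)) (?P (x \<circ> w \<circ> inv' x)) = mscale (\<theta>0 (x \<circ> w \<circ> inv' x)) (?P w)"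
      by (simp add: powsum_cycle_type_conjugate[OF xp])
  qed
  have "(\<Sum>w\<in>?S. mscale (ind_character ?G H \<theta> w) (?P w)) =
      (\<Sum>w\<in>?S. \<Sum>x\<in>?S. mscale (1 / of_nat (card H)) (mscale (\<theta>0 (x \<circ> w \<circ> inv' x)) (?P w)))"
    by (intro sum.cong[OF refl])
       (simp add: char sum_divide_distrib mscale_sum_left)
  also have "\<dots> = (\<Sum>x\<in>?S. mscale (1 / of_nat (card H)) (\<Sum>w\<in>?S. mscale (\<theta>0 (x \<circ> w \<circ> inv' x)) (?P w)))"
    unfolding mscale_sum_right by (rule sum.swap)
  also have "\<dots> = (\<Sum>x\<in>?S. mscale (1 / of_nat (card H)) ?K)"
    by (intro sum.cong[OF refl]) (simp only: conj)
  also have "\<dots> = mscale (fact n) (mscale (1 / of_nat (card H)) ?K)"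
    by (rule mpser_eqI) (simp only: mcoeff_sum mcoeff_mscale, simp add: card)
  finally show ?thesis
    by (simp add: frobenius_char_def)
qed

section \<open>Powers of the long cycle\<close>

lemma long_cycle_funpow_apply:
  assumes "i < n"
  shows "(long_cycle n ^^ k) (Suc i) = Suc ((k + i) mod n)"
proof -
  let ?xs = "[1..<Suc n]"
  have "map (long_cycle n ^^ k) ?xs = rotate k ?xs"
    unfolding long_cycle_def by (rule cyclic_rotation) simp
  then have "map (long_cycle n ^^ k) ?xs ! i = rotate k ?xs ! i"
    by (rule arg_cong)
  with assms show ?thesis
    by (simp add: nth_rotate del: upt_Suc)
qed

lemma long_cycle_permutes: "long_cycle n permutes {1..n}"
  using cycle_permutes[of "[1..<Suc n]"]
  by (simp only: long_cycle_def set_upt atLeastLessThanSuc_atLeastAtMost)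

lemma long_cycle_funpow_eq_iff:
  assumes n: "0 < n"
  shows "long_cycle n ^^ j = long_cycle n ^^ k \<longleftrightarrow> j mod n = k mod n"
proof
  assume "long_cycle n ^^ j = long_cycle n ^^ k"
  then have "(long_cycle n ^^ j) (Suc 0) = (long_cycle n ^^ k) (Suc 0)" by simp
  then show "j mod n = k mod n" using n by (simp add: long_cycle_funpow_apply)
next
  assume eq: "j mod n = k mod n"
  show "long_cycle n ^^ j = long_cycle n ^^ k"
  proof
    fix x
    show "(long_cycle n ^^ j) x = (long_cycle n ^^ k) x"
    proof (cases "x \<in> {1..n}")
      case True
      then obtain i where i: "x = Suc i" "i < n" by (cases x) auto
      have "(j + i) mod n = (k + i) mod n" using eq by (metis mod_add_left_eq)
      with i show ?thesis by (simp add: long_cycle_funpow_apply)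
    next
      case False
      then show ?thesis
        using permutes_not_in[OF permutes_funpow[OF long_cycle_permutes]] by metis
    qed
  qed
qed

lemma cyc_group_subgroup: "subgroup (cyc_group n) (sym_group n)"
  unfolding cyc_group_def
  by (rule group.generate_is_subgroup[OF sym_group_is_group])
     (simp add: sym_group_carrier long_cycle_permutes del: One_nat_def)

lemma bij_betw_cyc_group:
  assumes n: "0 < n"
  shows "bij_betw (\<lambda>k. long_cycle n ^^ k) {..<n} (cyc_group n)"
proof -
  interpret group "sym_group n" by (rule sym_group_is_group)
  have pow: "long_cycle n [^]\<^bsub>sym_group n\<^esub> k = long_cycle n ^^ k" for k :: nat
    by (induction k) (simp_all add: sym_group_one sym_group_mult funpow_Suc_right del: funpow.simps(2))
  have fin: "finite (carrier (sym_group n))"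
    by (simp add: sym_group_def finite_permutations)
  have "long_cycle n \<in> carrier (sym_group n)"
    by (simp only: sym_group_carrier long_cycle_permutes)
  then have "cyc_group n = range (\<lambda>k. long_cycle n ^^ k)"
    using generate_pow_on_finite_carrier[OF fin] by (auto simp: cyc_group_def pow)
  also have "\<dots> = (\<lambda>k. long_cycle n ^^ k) ` {..<n}"
  proof (intro equalityI subsetI)
    fix w assume "w \<in> range (\<lambda>k. long_cycle n ^^ k)"
    then obtain k where "w = long_cycle n ^^ k" by blast
    then have "w = long_cycle n ^^ (k mod n)" using long_cycle_funpow_eq_iff[OF n] by simp
    then show "w \<in> (\<lambda>k. long_cycle n ^^ k) ` {..<n}" using n by simp
  qed auto
  finally show ?thesis
    by (auto simp: bij_betw_def inj_on_def long_cycle_funpow_eq_iff[OF n])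
qed

text \<open>
  On \<open>{1..n}\<close> the \<open>k\<close>-th power of the long cycle acts as addition of \<open>k\<close> modulo \<open>n\<close>, and every point returns
  after exactly \<open>d = n / gcd(n, k)\<close> steps. The cycles therefore all have length \<open>d\<close>, and there are \<open>n / d\<close>.
\<close>

lemma powsum_cycle_type_long_cycle_funpow:
  fixes n k :: nat
  assumes n: "0 < n"
  defines "d \<equiv> n div gcd n k"
  shows "powsum_cycle_type n (long_cycle n ^^ k) = powsum d ^ (n div d)"
proof -
  let ?w = "long_cycle n ^^ k"
  have w: "?w permutes {1..n}" by (rule permutes_funpow[OF long_cycle_permutes])
  then have perm: "permutation ?w" by (auto simp: permutation_permutes)
  have d: "0 < d" using n by (auto simp: d_def dvd_div_eq_0_iff intro!: Nat.gr0I)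
  have ord: "(a * k) mod n = (b * k) mod n \<longleftrightarrow> a mod d = b mod d" for a b
  proof -
    define g k' where "g = gcd n k" and "k' = k div g"
    have g: "g \<noteq> 0" "n = g * d" "k = g * k'"
      using n by (simp_all add: g_def d_def k'_def)
    have "coprime k' d"
      using n unfolding k'_def d_def g_def by (metis coprime_commute div_gcd_coprime gcd_eq_0_iff less_irrefl)
    then have "(a * k') mod d = (b * k') mod d \<longleftrightarrow> a mod d = b mod d"
      using cong_mult_rcancel_nat[of k' d a b] by (simp add: cong_def)
    moreover have "(a * k) mod n = g * ((a * k') mod d)" for a
    proof -
      have "a * k = g * (a * k')" by (simp add: g(3))
      then show ?thesis by (simp only: g(2) mult_mod_right)
    qed
    ultimately show ?thesis using g(1) by simp
  qed
  have pow: "(?w ^^ a) (Suc i) = Suc ((a * k + i) mod n)" if "i < n" for a i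
    using that by (simp add: funpow_mult long_cycle_funpow_apply mult.commute)
  have pow_eq: "(?w ^^ a) x = (?w ^^ b) x \<longleftrightarrow> a mod d = b mod d" if "x \<in> {1..n}" for a b x
  proof -
    from that obtain i where i: "x = Suc i" "i < n" by (cases x) auto
    have "(a * k + i) mod n = (b * k + i) mod n \<longleftrightarrow> (a * k) mod n = (b * k) mod n"
      using cong_add_rcancel_nat[of "a * k" i "b * k" n] by (simp add: cong_def)
    then show ?thesis using i by (simp add: pow ord)
  qed
  have card_orbit: "card (orbit ?w x) = d" if x: "x \<in> {1..n}" for x
  proof -
    have "(?w ^^ d) x = x" using pow_eq[OF x, of d 0] by simp
    then have "orbit ?w x = (\<lambda>a. (?w ^^ a) x) ` {..<d}"
      using orbit_altdef_bounded[of d ?w x] d by auto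
    moreover have "inj_on (\<lambda>a. (?w ^^ a) x) {..<d}"
      by (auto simp: inj_on_def pow_eq[OF x])
    ultimately show ?thesis by (simp add: card_image)
  qed
  have union: "\<Union> (orbit ?w ` {1..n}) = {1..n}"
    using permutes_orbit_subset[OF w] permutation_self_in_orbit[OF perm] by blast
  have "d * card (orbit ?w ` {1..n}) = card (\<Union> (orbit ?w ` {1..n}))"
  proof (rule card_partition)
    show "finite (\<Union> (orbit ?w ` {1..n}))"
      by (simp only: union finite_atLeastAtMost)
    show "c1 \<inter> c2 = {}" if "c1 \<in> orbit ?w ` {1..n}" "c2 \<in> orbit ?w ` {1..n}" "c1 \<noteq> c2" for c1 c2
      using that orbit_cyclic_eq3[OF cyclic_on_orbit'[OF perm]] by blast
  qed (use card_orbit in auto)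
  also have "\<dots> = n"
    by (simp only: union) simp
  finally have "card (orbit ?w ` {1..n}) = n div d"
    using d by (metis nonzero_mult_div_cancel_left less_irrefl)
  moreover have "powsum_cycle_type n ?w = (\<Prod>C\<in>orbit ?w ` {1..n}. powsum d)"
    unfolding powsum_cycle_type_def using card_orbit by (intro prod.cong) auto
  ultimately show ?thesis
    by simp
qed

section \<open>Ramanujan sums\<close>

definition root_of_unity :: "nat \<Rightarrow> int \<Rightarrow> complex"
  where "root_of_unity n r = cis (2 * pi * real_of_int r / real n)"

lemma root_of_unity_power:
  assumes "m dvd n" "0 < n"
  shows "root_of_unity n r ^ (n div m) = root_of_unity m r"
proof -
  obtain k where k: "n = m * k" using assms(1) by blast
  with assms have "m > 0" "k > 0" by auto
  then show ?thesis
    by (simp add: k root_of_unity_def Complex.DeMoivre)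
qed

lemma root_of_unity_power_self:
  assumes "0 < n"
  shows "root_of_unity n r ^ n = 1"
  using assms by (auto simp: root_of_unity_def Complex.DeMoivre cis_eq_1_iff mult.commute)

lemma root_of_unity_eq_1_iff:
  assumes m: "0 < m"
  shows "root_of_unity m r = 1 \<longleftrightarrow> int m dvd r"
proof -
  have "2 * pi * real_of_int r / real m = real_of_int k * (2 * pi) \<longleftrightarrow> r = int m * k" for k
  proof -
    have "2 * pi * real_of_int r / real m = real_of_int k * (2 * pi) \<longleftrightarrow>
        real_of_int r = real m * real_of_int k"
      using m by (auto simp: field_simps)
    also have "\<dots> \<longleftrightarrow> real_of_int r = real_of_int (int m * k)" by simp
    finally show ?thesis by (simp only: of_int_eq_iff)
  qed
  then show ?thesis
    by (simp add: root_of_unity_def cis_eq_1_iff dvd_def)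
qed

lemma sum_root_of_unity_powers:
  assumes m: "0 < m"
  shows "(\<Sum>j<m. root_of_unity m r ^ j) = (if int m dvd r then of_nat m else 0)"
proof (cases "int m dvd r")
  case True
  then have "root_of_unity m r = 1" using m by (simp only: root_of_unity_eq_1_iff)
  with True show ?thesis by simp
next
  case False
  then have "root_of_unity m r \<noteq> 1" using m by (simp only: root_of_unity_eq_1_iff not_False_eq_True)
  then show ?thesis
    using False by (simp add: geometric_sum root_of_unity_power_self[OF m])
qed

text \<open>
  The least exponent in the definition of the scalar may be replaced by any other, because two
  exponents of the same power of the long cycle are congruent modulo \<open>n\<close>, and the \<open>n\<close>-th power of the
  root of unity is 1.
\<close>

lemma cyc_scalar_funpow:
  assumes n: "0 < n"
  shows "cyc_scalar n r (long_cycle n ^^ k) = root_of_unity n r ^ k"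
proof -
  define j where "j = (LEAST j. long_cycle n ^^ k = long_cycle n ^^ j)"
  have "long_cycle n ^^ k = long_cycle n ^^ j"
    unfolding j_def by (rule LeastI[of _ k]) simp
  then have eq: "j mod n = k mod n" using long_cycle_funpow_eq_iff[OF n] by simp
  have red: "root_of_unity n r ^ i = root_of_unity n r ^ (i mod n)" for i
  proof -
    have "root_of_unity n r ^ i = root_of_unity n r ^ (n * (i div n) + i mod n)" by simp
    also have "\<dots> = root_of_unity n r ^ (i mod n)"
      by (simp only: power_add power_mult root_of_unity_power_self[OF n] power_one mult_1)
    finally show ?thesis .
  qed
  have "root_of_unity n r ^ j = root_of_unity n r ^ k"
    using red[of j] red[of k] eq by simp
  moreover have "exp (2 * of_real pi * \<i> * of_int r / of_nat n) = root_of_unity n r"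
    by (simp add: root_of_unity_def cis_conv_exp mult_ac)
  ultimately show ?thesis by (simp only: cyc_scalar_def j_def)
qed

lemma ell_as_sum_over_powers:
  assumes n: "0 < n"
  shows "ell n r = mscale (1 / of_nat n)
    (\<Sum>k<n. mscale (root_of_unity n r ^ k) (powsum_cycle_type n (long_cycle n ^^ k)))"
proof -
  note bij = bij_betw_cyc_group[OF n]
  have mult: "cyc_scalar n r (h \<circ> k) = cyc_scalar n r h * cyc_scalar n r k"
    if hk: "h \<in> cyc_group n" "k \<in> cyc_group n" for h k
  proof -
    obtain i j where "h = long_cycle n ^^ i" "k = long_cycle n ^^ j"
      using hk unfolding bij_betw_imp_surj_on[OF bij, symmetric] by blast
    then show ?thesis
      by (simp add: cyc_scalar_funpow[OF n] power_add flip: funpow_add)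
  qed
  have "ell n r = mscale (1 / of_nat (card (cyc_group n)))
      (\<Sum>w\<in>cyc_group n. mscale (cyc_scalar n r w) (powsum_cycle_type n w))"
    unfolding ell_def by (rule frobenius_char_induced[OF cyc_group_subgroup mult])
  also have "card (cyc_group n) = n"
    using bij_betw_same_card[OF bij] by simp
  also have "(\<Sum>w\<in>cyc_group n. mscale (cyc_scalar n r w) (powsum_cycle_type n w)) =
      (\<Sum>k<n. mscale (root_of_unity n r ^ k) (powsum_cycle_type n (long_cycle n ^^ k)))"
    by (simp add: sum.reindex_bij_betw[OF bij, symmetric] cyc_scalar_funpow[OF n])
  finally show ?thesis .
qed

lemma quotient_gcd_dvd_iff:
  fixes n m k :: nat
  assumes n: "0 < n" and m: "m dvd n"
  shows "n div gcd n k dvd m \<longleftrightarrow> n div m dvd k"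
proof -
  have "m \<noteq> 0" using assms by auto
  have "n div gcd n k dvd m \<longleftrightarrow> n dvd m * gcd n k"
    using n by (subst div_dvd_iff_mult) auto
  also have "\<dots> \<longleftrightarrow> n dvd m * k"
    by (simp add: gcd_mult_distrib_nat)
  also have "\<dots> \<longleftrightarrow> n div m dvd k"
    using \<open>m \<noteq> 0\<close> m by (subst div_dvd_iff_mult) (auto simp: mult.commute)
  finally show ?thesis .
qed

text \<open>
  The classical evaluation of a Ramanujan sum, by comparison of divisor sums. Summing the left-hand
  sides over \<open>d dvd m\<close> collects the exponents \<open>k\<close> that are multiples of \<open>n / m\<close>; this is a full sum of
  powers of an \<open>m\<close>-th root of unity, equal to \<open>m\<close> if \<open>m dvd r\<close> and to 0 otherwise, and the right-hand
  sides have the same divisor sums by Moebius inversion.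
\<close>

lemma ramanujan_sum_eq_psi:
  assumes n: "0 < n" and d: "d \<in> pos_divisors n"
  shows "(\<Sum>k | k < n \<and> n div gcd n k = d. root_of_unity n (int r) ^ k) = of_int (psi (pos_divisors r) d)"
proof (rule divisor_sums_determine[OF _ d])
  let ?\<omega> = "root_of_unity n (int r)"
  fix m assume "m \<in> pos_divisors n"
  then have m: "0 < m" "m dvd n" by (auto simp: pos_divisors_def)
  let ?K = "{k. k < n \<and> n div m dvd k}"
  have nm: "0 < n div m" using m n by (auto simp: dvd_div_eq_0_iff intro!: Nat.gr0I)
  \<comment> \<open>An exponent belongs to one of the classes \<open>d dvd m\<close> exactly if it is a multiple of \<open>n / m\<close>.\<close>
  have K: "?K = {k. k < n \<and> n div gcd n k dvd m}"
    using quotient_gcd_dvd_iff[OF n m(2)] by auto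
  have "(\<Sum>d\<in>pos_divisors m. \<Sum>k | k < n \<and> n div gcd n k = d. ?\<omega> ^ k) =
      (\<Sum>d\<in>pos_divisors m. \<Sum>k | k \<in> ?K \<and> n div gcd n k = d. ?\<omega> ^ k)"
    unfolding K by (intro sum.cong) (auto simp: pos_divisors_def)
  also have "\<dots> = (\<Sum>k\<in>?K. ?\<omega> ^ k)"
  proof (rule sum.group)
    show "(\<lambda>k. n div gcd n k) ` ?K \<subseteq> pos_divisors m"
      unfolding K using n by (auto simp: pos_divisors_def intro!: Nat.gr0I simp: dvd_div_eq_0_iff)
  qed (use m in auto)
  also have "\<dots> = (\<Sum>j<m. (?\<omega> ^ (n div m)) ^ j)"
  proof (rule sum.reindex_bij_witness[where i = "\<lambda>j. n div m * j" and j = "\<lambda>k. k div (n div m)"])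
    fix k assume k: "k \<in> ?K"
    then show "n div m * (k div (n div m)) = k" by simp
    then show "(?\<omega> ^ (n div m)) ^ (k div (n div m)) = ?\<omega> ^ k" by (simp flip: power_mult)
    have "k < m * (n div m)" using k m by simp
    then show "k div (n div m) \<in> {..<m}" using nm by (simp add: div_less_iff_less_mult)
  next
    fix j assume "j \<in> {..<m}"
    then have "n div m * j < n div m * m" using nm by simp
    then show "n div m * j \<in> ?K" using m by simp
    show "n div m * j div (n div m) = j" using nm by simp
  qed
  also have "\<dots> = (if m \<in> pos_divisors r then of_nat m else 0)"
    using m n by (simp only: root_of_unity_power sum_root_of_unity_powers) (simp add: pos_divisors_def)
  also have "\<dots> = of_int (\<Sum>d\<in>pos_divisors m. psi (pos_divisors r) d)"
    using m by (simp add: sum_psi_divisors)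
  finally show "(\<Sum>d\<in>pos_divisors m. \<Sum>k | k < n \<and> n div gcd n k = d. ?\<omega> ^ k) =
      (\<Sum>d\<in>pos_divisors m. of_int (psi (pos_divisors r) d))"
    by simp
qed

lemma ell_eq_fT:
  assumes n: "0 < n"
  shows "ell n (int r) = fT (pos_divisors r) n"
proof -
  let ?\<omega> = "root_of_unity n (int r)"
  let ?q = "\<lambda>d. powsum d ^ (n div d)"
  have "(\<Sum>k<n. mscale (?\<omega> ^ k) (powsum_cycle_type n (long_cycle n ^^ k))) =
      (\<Sum>k\<in>{..<n}. mscale (?\<omega> ^ k) (?q (n div gcd n k)))"
    using n by (simp add: powsum_cycle_type_long_cycle_funpow)
  also have "\<dots> = (\<Sum>d\<in>pos_divisors n. \<Sum>k | k \<in> {..<n} \<and> n div gcd n k = d. mscale (?\<omega> ^ k) (?q (n div gcd n k)))"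
    by (rule sum.group[symmetric])
       (use n in \<open>auto simp: pos_divisors_def dvd_div_eq_0_iff div_dvd_iff_mult intro!: Nat.gr0I finite_pos_divisors[unfolded pos_divisors_def]\<close>)
  also have "\<dots> = (\<Sum>d\<in>pos_divisors n. mscale (of_int (psi (pos_divisors r) d)) (?q d))"
    using n by (intro sum.cong[OF refl]) (simp add: ramanujan_sum_eq_psi[symmetric] mscale_sum_left)
  finally show ?thesis
    by (simp add: ell_as_sum_over_powers[OF n] fT_def)
qed

section \<open>Nonnegative combinations\<close>

lemma psi_cong:
  assumes "T \<inter> pos_divisors n = U \<inter> pos_divisors n" "d \<in> pos_divisors n"
  shows "psi T d = psi U d"
proof -
  have "pos_divisors d \<subseteq> pos_divisors n"
    using assms(2) by (auto simp: pos_divisors_def intro: dvd_trans)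
  with assms(1) have "pos_divisors d \<inter> T = pos_divisors d \<inter> U" by blast
  then show ?thesis by (simp add: psi_def)
qed

lemma fT_cong:
  assumes "T \<inter> pos_divisors n = U \<inter> pos_divisors n"
  shows "fT T n = fT U n"
  using psi_cong[OF assms] by (simp add: fT_def)

lemma fT_empty: "fT {} n = 0"
  by (rule mpser_eqI) (simp add: fT_def psi_def)

text \<open>
  Comparing the coefficients of \<open>p\<^sub>d\<^sup>n\<^sup>/\<^sup>d\<close> gives \<open>\<psi>\<^sup>T(d) = \<Sum>\<^sub>e b\<^sub>e \<psi>\<^sup>U(d)\<close> with \<open>U\<close> the divisors of \<open>e\<close>, and divisor
  sums of this relation say how the indicator of \<open>T\<close> is obtained from the weights \<open>b\<close>.
\<close>

lemma fT_in_F_plus_imp_divisor_set: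
  assumes n: "0 < n" and mem: "fT T n \<in> F_plus n"
  shows "T \<inter> pos_divisors n = {} \<or> (\<exists>r. r dvd n \<and> T \<inter> pos_divisors n = pos_divisors r)"
proof -
  let ?D = "pos_divisors n"
  let ?q = "\<lambda>d. powsum d ^ (n div d)"
  from mem obtain b :: "nat \<Rightarrow> real" where b: "\<forall>e\<in>?D. 0 \<le> b e"
    and eq: "fT T n = (\<Sum>e\<in>?D. mscale (of_real (b e)) (ell n (int e)))"
    unfolding F_plus_def by blast
  define c where "c d = (of_int (psi T d) - (\<Sum>e\<in>?D. of_real (b e) * of_int (psi (pos_divisors e) d)) :: complex)" for d
  have fT: "of_nat n * mcoeff (fT U n) M = (\<Sum>d\<in>?D. of_int (psi U d) * mcoeff (?q d) M)" for U M
    using n by (simp add: fT_def)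
  have "(\<Sum>d\<in>?D. mscale (c d) (?q d)) = 0"
  proof (rule mpser_eqI)
    fix M
    have "(\<Sum>d\<in>?D. of_int (psi T d) * mcoeff (?q d) M) = of_nat n * mcoeff (fT T n) M"
      by (simp only: fT)
    also have "\<dots> = (\<Sum>e\<in>?D. of_real (b e) * (of_nat n * mcoeff (fT (pos_divisors e) n) M))"
      by (simp add: eq ell_eq_fT[OF n] sum_distrib_left mult_ac)
    also have "\<dots> = (\<Sum>e\<in>?D. \<Sum>d\<in>?D. of_real (b e) * of_int (psi (pos_divisors e) d) * mcoeff (?q d) M)"
      by (simp only: fT sum_distrib_left mult.assoc)
    also have "\<dots> = (\<Sum>d\<in>?D. (\<Sum>e\<in>?D. of_real (b e) * of_int (psi (pos_divisors e) d)) * mcoeff (?q d) M)"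
      unfolding sum_distrib_right by (rule sum.swap)
    finally show "mcoeff (\<Sum>d\<in>?D. mscale (c d) (?q d)) M = mcoeff 0 M"
      by (simp add: c_def left_diff_distrib sum_subtractf)
  qed
  then have c0: "c d = 0" if "d \<in> ?D" for d
    using powsum_powers_independent[OF n] that by blast
  \<comment> \<open>The comparison happens over the complex numbers, but the sign argument needs it over the reals.\<close>
  have psi_eq: "real_of_int (psi T d) = (\<Sum>e\<in>?D. b e * real_of_int (psi (pos_divisors e) d))" if "d \<in> ?D" for d
  proof -
    have "complex_of_real (real_of_int (psi T d)) =
        complex_of_real (\<Sum>e\<in>?D. b e * real_of_int (psi (pos_divisors e) d))"
      using c0[OF that] by (simp add: c_def)
    then show ?thesis by (simp only: of_real_eq_iff)
  qed
  have ind: "(if m \<in> T then 1 else 0) = (\<Sum>e | e \<in> ?D \<and> m dvd e. b e)" if "m \<in> ?D" for m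
  proof -
    have m: "0 < m" "m dvd n" using that by (auto simp: pos_divisors_def)
    have sub: "d \<in> ?D" if "d \<in> pos_divisors m" for d
      using that m by (auto simp: pos_divisors_def intro: dvd_trans)
    have psi_sum: "(\<Sum>d\<in>pos_divisors m. real_of_int (psi U d)) = (if m \<in> U then real m else 0)" for U
      using sum_psi_divisors[OF m(1), of U] by (simp flip: of_int_sum)
    have "(if m \<in> T then real m else 0) = (\<Sum>d\<in>pos_divisors m. \<Sum>e\<in>?D. b e * real_of_int (psi (pos_divisors e) d))"
      using sub by (simp add: psi_sum[symmetric] psi_eq)
    also have "\<dots> = (\<Sum>e\<in>?D. b e * (\<Sum>d\<in>pos_divisors m. real_of_int (psi (pos_divisors e) d)))"
      unfolding sum_distrib_left by (rule sum.swap)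
    also have "\<dots> = (\<Sum>e\<in>?D. if m dvd e then b e * real m else 0)"
      unfolding psi_sum using m by (intro sum.cong) (auto simp: pos_divisors_def)
    also have "\<dots> = (\<Sum>e | e \<in> ?D \<and> m dvd e. b e * real m)"
      using n by (simp add: sum.inter_filter)
    also have "\<dots> = (\<Sum>e | e \<in> ?D \<and> m dvd e. b e) * real m"
      by (simp add: sum_distrib_right)
    finally show ?thesis using m by (auto split: if_splits)
  qed
  show ?thesis
    by (rule nonneg_indicator_combination[OF n _ ind]) (use b in auto)
qed

lemma zero_in_F_plus: "0 \<in> F_plus n"
  unfolding F_plus_def by (rule CollectI, rule exI[of _ "\<lambda>_. 0"]) simp

lemma ell_in_F_plus:
  assumes n: "0 < n" and r: "r dvd n"
  shows "ell n (int r) \<in> F_plus n"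
proof -
  have "(\<Sum>e\<in>pos_divisors n. mscale (of_real (if e = r then 1 else 0)) (ell n (int e))) =
      (\<Sum>e\<in>pos_divisors n. if e = r then ell n (int e) else 0)"
    by (intro sum.cong) auto
  also have "\<dots> = ell n (int r)"
    using n r by (simp add: pos_divisors_positive)
  finally show ?thesis
    unfolding F_plus_def by (intro CollectI exI[of _ "\<lambda>e. if e = r then 1 else 0"]) simp
qed

theorem proposition2p12:
  fixes n :: nat and T :: "nat set"
  assumes "n \<ge> 1" and "T \<subseteq> {1..}"
  shows "(fT T n \<in> F_plus n \<longleftrightarrow>
            T \<inter> pos_divisors n = {} \<or> (\<exists>r. r dvd n \<and> T \<inter> pos_divisors n = pos_divisors r))
       \<and> (T \<inter> pos_divisors n = {} \<or> (\<exists>r. r dvd n \<and> T \<inter> pos_divisors n = pos_divisors r) \<longleftrightarrow>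
            fT T n = 0 \<or> (\<exists>r. r dvd n \<and> fT T n = ell n (int r)))"
    (is "(?i \<longleftrightarrow> ?ii) \<and> (?ii \<longleftrightarrow> ?iii)")
proof -
  have n: "0 < n" using assms(1) by simp
  have "?ii \<Longrightarrow> ?iii"
  proof (elim disjE exE conjE)
    assume "T \<inter> pos_divisors n = {}"
    then have "fT T n = fT {} n" by (intro fT_cong) simp
    then show ?iii by (simp add: fT_empty)
  next
    fix r assume r: "r dvd n" and T: "T \<inter> pos_divisors n = pos_divisors r"
    then have "T \<inter> pos_divisors n = pos_divisors r \<inter> pos_divisors n" by blast
    then have "fT T n = ell n (int r)"
      unfolding ell_eq_fT[OF n] by (rule fT_cong)
    with r show ?iii by blast
  qed
  moreover have "?iii \<Longrightarrow> ?i"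
    using zero_in_F_plus ell_in_F_plus[OF n] by auto
  moreover have "?i \<Longrightarrow> ?ii"
    by (rule fT_in_F_plus_imp_divisor_set[OF n])
  ultimately show ?thesis by blast
qed

end
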